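(* For each integer $n\ge 2$, let $(k_n,l_n)$ be any pair of positive integers $(k,l)$ with $l\le k\le n-1$ that minimizes $E_n(k,l)$ over all such pairs. Then, as $n\to\infty$, $$k_n\sim\frac{n}{\mathrm{e}},\qquad l_n\sim\log n-1,\qquad E_n(k_n,l_n)\sim\frac{\mathrm{e}}{2}\log n,$$ where $\log$ is the natural logarithm and $f(n)\sim g(n)$ means $f(n)/g(n)\to 1$.
   Context: The stopping rule $\mathcal{R}_n(k,l)$ (for positive integers $l\le k\le n-1$) selects an element $s$ of a permutation $a_1,a_2,\dots,a_n$ of $\{1,2,\dots,n\}$ as follows. Let $t$ be the $l$-th lowest value among $a_1,\dots,a_k$, and let $I=\{i\in\{1,\dots,n-k\} : a_{k+i}<t\}$. Let $j=\min I$ if $I\ne\emptyset$ and $j=n-k$ if $I=\emptyset$. The rule selects $s=a_{k+j}$. $E_n(k,l)$ denotes the expected value of $s$ when the permutation is uniformly random among all $n!$ permutations. *)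

theory Defs
  imports "HOL-Probability.Probability" "HOL-Library.Landau_Symbols"
    "HOL-Combinatorics.Permutations"
begin

text \<open>A permutation \<open>a\<^sub>1, \<dots>, a\<^sub>n\<close> of \<open>{1..n}\<close> is a function \<open>a\<close> with \<open>a permutes {1..n}\<close>.\<close>

definition threshold :: "nat \<Rightarrow> nat \<Rightarrow> (nat \<Rightarrow> nat) \<Rightarrow> nat" where
  "threshold k l a = sorted_list_of_set (a ` {1..k}) ! (l - 1)"

definition rule_select :: "nat \<Rightarrow> nat \<Rightarrow> nat \<Rightarrow> (nat \<Rightarrow> nat) \<Rightarrow> nat" where
  "rule_select n k l a =
     (let t = threshold k l a;
          I = {i \<in> {1..n - k}. a (k + i) < t};
          j = (if I \<noteq> {} then Min I else n - k)
      in a (k + j))"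

definition expected_select :: "nat \<Rightarrow> nat \<Rightarrow> nat \<Rightarrow> real" where
  "expected_select n k l =
     measure_pmf.expectation (pmf_of_set {a. a permutes {1..n}})
       (\<lambda>a. real (rule_select n k l a))"

end

(*
Let T be the threshold of a. Reflecting the values {1..T-1} (if T > l) or {l+1..n} (if T = l)
is an involution on permutations that keeps T; it maps the selected value s to T - s, respectively
n + l + 1 - s. Averaging gives E s = E T / 2 + (n+1)/2 * P(T = l), that is
  E_n(k,l) = (n+1)/2 * (l/(k+1) + C(k,l)/C(n,l)).
For k about n/e and l about ln n the bracket is at most (e ln n + O(1))/n. Conversely, put
w = ln (n/(k+1)) and r = l / ln n at a minimizer. The first summand yields r e^w <= e + o(1); the
second one is about e^(-lw), which yields r w >= 1 - o(1). Hence e^(w-1) <= w (1 + o(1)), which forces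
w -> 1 and then r -> 1.
*)
theory Submission
  imports Defs "HOL-Real_Asymp.Real_Asymp"
begin

section \<open>Order statistics of uniformly random subsets\<close>

lemma sorted_list_of_set_nth_props:
  fixes S :: "'a::linorder set"
  assumes "finite S" "i < card S"
  shows "sorted_list_of_set S ! i \<in> S"
    and "card {x \<in> S. x < sorted_list_of_set S ! i} = i"
proof -
  let ?xs = "sorted_list_of_set S"
  have len: "length ?xs = card S" and set: "set ?xs = S" using assms by auto
  have s: "sorted_wrt (<) ?xs" by (rule strict_sorted_list_of_set)
  show "?xs ! i \<in> S" using len set assms(2) by (metis nth_mem)
  have "{x \<in> S. x < ?xs ! i} = (!) ?xs ` {..<i}"
  proof (intro equalityI subsetI)
    fix x assume "x \<in> {x \<in> S. x < ?xs ! i}"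
    then obtain j where j: "j < card S" "x = ?xs ! j" "?xs ! j < ?xs ! i"
      using set len by (metis (no_types, lifting) in_set_conv_nth mem_Collect_eq)
    then have "j < i" using s len assms(2)
      by (metis linorder_neqE_nat order_less_asym order_less_irrefl sorted_wrt_nth_less)
    then show "x \<in> (!) ?xs ` {..<i}" using j by blast
  next
    fix x assume "x \<in> (!) ?xs ` {..<i}"
    then obtain j where "j < i" "x = ?xs ! j" by auto
    then show "x \<in> {x \<in> S. x < ?xs ! i}"
      using s len set assms(2) by (metis (no_types, lifting) mem_Collect_eq nth_mem order_less_trans sorted_wrt_nth_less)
  qed
  moreover have "inj_on ((!) ?xs) {..<i}"
    using len assms(2) by (intro inj_on_nth) auto
  ultimately show "card {x \<in> S. x < ?xs ! i} = i" by (simp add: card_image)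
qed

text \<open>Counting smaller elements determines the index, so order statistics can be identified by
  a cardinality; the later evaluations go through this rule.\<close>

lemma sorted_list_of_set_nth_eqI:
  fixes S :: "'a::linorder set"
  assumes "finite S" "x \<in> S" "card {y \<in> S. y < x} = i"
  shows "sorted_list_of_set S ! i = x"
proof -
  obtain j where j: "j < card S" "sorted_list_of_set S ! j = x"
    using assms(1,2) by (metis in_set_conv_nth length_sorted_list_of_set set_sorted_list_of_set)
  then show ?thesis using sorted_list_of_set_nth_props(2)[OF assms(1) j(1)] assms(3) by simp
qed

section \<open>Sums of order statistics over k-subsets\<close>

abbreviation ksubsets :: "nat \<Rightarrow> nat \<Rightarrow> nat set set" where
  "ksubsets n k \<equiv> {S. S \<subseteq> {1..n} \<and> card S = k}"

abbreviation order_stat :: "nat \<Rightarrow> nat set \<Rightarrow> nat" where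
  "order_stat l S \<equiv> sorted_list_of_set S ! (l - 1)"

lemma ksubsets_Suc:
  "ksubsets (Suc n) (Suc k) = ksubsets n (Suc k) \<union> insert (Suc n) ` ksubsets n k"
proof (intro equalityI subsetI)
  fix S assume S: "S \<in> ksubsets (Suc n) (Suc k)"
  show "S \<in> ksubsets n (Suc k) \<union> insert (Suc n) ` ksubsets n k"
  proof (cases "Suc n \<in> S")
    case True
    have "finite S" using S finite_subset by blast
    then have "card (S - {Suc n}) = k" using S True by simp
    moreover have "S - {Suc n} \<subseteq> {1..n}" using S by (auto simp: atLeastAtMostSuc_conv)
    moreover have "S = insert (Suc n) (S - {Suc n})" using True by auto
    ultimately show ?thesis by blast
  next
    case False
    then have "S \<subseteq> {1..n}" using S by (auto simp: atLeastAtMostSuc_conv)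
    then show ?thesis using S by blast
  qed
next
  fix S assume "S \<in> ksubsets n (Suc k) \<union> insert (Suc n) ` ksubsets n k"
  then show "S \<in> ksubsets (Suc n) (Suc k)"
  proof
    assume "S \<in> ksubsets n (Suc k)"
    then show ?thesis by auto
  next
    assume "S \<in> insert (Suc n) ` ksubsets n k"
    then obtain R where R: "R \<subseteq> {1..n}" "card R = k" "S = insert (Suc n) R" by auto
    have "finite R" using R(1) finite_subset by blast
    moreover have "Suc n \<notin> R" using R(1) by auto
    ultimately have "card S = Suc k" using R by simp
    then show ?thesis using R by auto
  qed
qed

lemma sum_ksubsets_Suc:
  fixes f :: "nat set \<Rightarrow> 'a::comm_monoid_add"
  shows "sum f (ksubsets (Suc n) (Suc k)) =
    sum f (ksubsets n (Suc k)) + (\<Sum>S\<in>ksubsets n k. f (insert (Suc n) S))"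
proof -
  have "inj_on (insert (Suc n)) (ksubsets n k)"
  proof (rule inj_onI)
    fix A B assume *: "A \<in> ksubsets n k" "B \<in> ksubsets n k" "insert (Suc n) A = insert (Suc n) B"
    have "Suc n \<notin> A" "Suc n \<notin> B" using * by auto
    then show "A = B" using *(3) by (metis Diff_insert_absorb)
  qed
  moreover have "ksubsets n (Suc k) \<inter> insert (Suc n) ` ksubsets n k = {}" by auto
  ultimately show ?thesis
    unfolding ksubsets_Suc by (subst sum.union_disjoint) (simp_all add: sum.reindex)
qed

lemma order_stat_insert_top:
  assumes "S \<subseteq> {1..n}" "1 \<le> l" "l \<le> card S"
  shows "order_stat l (insert (Suc n) S) = order_stat l S"
proof -
  have fin: "finite S" using assms(1) finite_subset by blast
  let ?t = "order_stat l S"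
  have t: "?t \<in> S" "card {x \<in> S. x < ?t} = l - 1"
    using sorted_list_of_set_nth_props[OF fin, of "l - 1"] assms by auto
  then have "?t < Suc n" using assms(1) by auto
  then have "{x \<in> insert (Suc n) S. x < ?t} = {x \<in> S. x < ?t}" by auto
  then show ?thesis using t fin by (intro sorted_list_of_set_nth_eqI) auto
qed

lemma order_stat_insert_top_last:
  assumes "S \<subseteq> {1..n}" "l = Suc (card S)"
  shows "order_stat l (insert (Suc n) S) = Suc n"
proof -
  have fin: "finite S" using assms(1) finite_subset by blast
  have "{x \<in> insert (Suc n) S. x < Suc n} = S" using assms(1) by auto
  then show ?thesis using fin assms by (intro sorted_list_of_set_nth_eqI) auto
qed

text \<open>Induction on \<open>n\<close>, separating the subsets that contain the top element
  \<open>Suc n\<close>; the two parts add up by Pascal's rule. Divided by \<open>n choose k\<close>,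
  the result says that the \<open>l\<close>-th order statistic of a random k-subset has mean
  \<open>l * (n + 1) / (k + 1)\<close>.\<close>

lemma sum_order_stat:
  assumes "1 \<le> l" "l \<le> k"
  shows "(\<Sum>S\<in>ksubsets n k. order_stat l S) = l * (Suc n choose Suc k)"
  using assms
proof (induction n arbitrary: k)
  case 0
  then have "ksubsets 0 k = {}" by auto
  then show ?case using 0 by (simp only: sum.empty) simp
next
  case (Suc n)
  then obtain k' where k: "k = Suc k'" by (cases k) auto
  have "(\<Sum>S\<in>ksubsets n k'. order_stat l (insert (Suc n) S)) = l * (Suc n choose k)"
  proof (cases "l \<le> k'")
    case True
    have "(\<Sum>S\<in>ksubsets n k'. order_stat l (insert (Suc n) S)) = (\<Sum>S\<in>ksubsets n k'. order_stat l S)"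
      using True Suc.prems by (intro sum.cong refl order_stat_insert_top) auto
    then show ?thesis using Suc.IH[of k'] True Suc.prems k by simp
  next
    case False
    \<comment> \<open>Here \<open>l = k\<close>, so the added top element is itself the
      \<open>l\<close>-th lowest, and the absorption identity replaces the induction
      hypothesis.\<close>
    then have l: "l = Suc k'" using Suc.prems k by auto
    have "(\<Sum>S\<in>ksubsets n k'. order_stat l (insert (Suc n) S)) = (\<Sum>S\<in>ksubsets n k'. Suc n)"
      using l by (intro sum.cong refl order_stat_insert_top_last) auto
    also have "\<dots> = (n choose k') * Suc n" using n_subsets[of "{1..n}" k'] by simp
    also have "\<dots> = l * (Suc n choose k)" using Suc_times_binomial[of k' n] l k by (simp add: mult.commute)
    finally show ?thesis .
  qed
  then show ?case using Suc.IH[of k] Suc.prems unfolding k sum_ksubsets_Suc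
    by (simp add: k algebra_simps)
qed

text \<open>The \<open>l\<close>-th lowest of a set of positive integers equals \<open>l\<close>
  only if nothing below it is missing. For the rule this is the event that no value under the
  threshold is left after the prefix, so that the last element has to be taken.\<close>

lemma order_stat_eq_rank_iff:
  assumes "S \<subseteq> {1..n}" "1 \<le> l" "l \<le> card S"
  shows "order_stat l S = l \<longleftrightarrow> {1..l} \<subseteq> S"
proof
  have fin: "finite S" using assms(1) finite_subset by blast
  assume eq: "order_stat l S = l"
  then have l: "l \<in> S" "card {x \<in> S. x < l} = l - 1"
    using sorted_list_of_set_nth_props[OF fin, of "l - 1"] assms by auto
  have "{x \<in> S. x < l} = {1..<l}"
    using l(2) assms(1) by (intro card_subset_eq) auto
  then show "{1..l} \<subseteq> S" using l(1)
    by (metis (no_types, lifting) atLeastAtMost_iff atLeastLessThan_iff le_neq_implies_less mem_Collect_eq subsetI)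
next
  have fin: "finite S" using assms(1) finite_subset by blast
  assume sub: "{1..l} \<subseteq> S"
  have "{x \<in> S. x < l} = {1..<l}"
    using sub assms(1) by auto
  moreover have "l \<in> S" using sub assms(2) by auto
  ultimately show "order_stat l S = l" using fin by (intro sorted_list_of_set_nth_eqI) auto
qed

text \<open>Such a subset is determined by its \<open>k - l\<close> elements above
  \<open>l\<close>.\<close>

lemma card_ksubsets_containing:
  assumes "l \<le> k" "l \<le> n"
  shows "card {S \<in> ksubsets n k. {1..l} \<subseteq> S} = (n - l) choose (k - l)"
proof -
  have "bij_betw (\<lambda>S. S - {1..l}) {S \<in> ksubsets n k. {1..l} \<subseteq> S}
      {R. R \<subseteq> {l<..n} \<and> card R = k - l}"
  proof (rule bij_betw_byWitness[where f' = "\<lambda>R. R \<union> {1..l}"])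
    show "(\<lambda>S. S - {1..l}) ` {S \<in> ksubsets n k. {1..l} \<subseteq> S} \<subseteq> {R. R \<subseteq> {l<..n} \<and> card R = k - l}"
      by (auto simp: card_Diff_subset)
    show "(\<lambda>R. R \<union> {1..l}) ` {R. R \<subseteq> {l<..n} \<and> card R = k - l} \<subseteq> {S \<in> ksubsets n k. {1..l} \<subseteq> S}"
    proof (rule image_subsetI)
      fix R assume "R \<in> {R. R \<subseteq> {l<..n} \<and> card R = k - l}"
      then have R: "R \<subseteq> {l<..n}" "card R = k - l" by auto
      have "finite R" using R(1) finite_subset by blast
      moreover have "R \<inter> {1..l} = {}" using R(1) by fastforce
      ultimately have "card (R \<union> {1..l}) = k" using R(2) assms by (simp add: card_Un_disjoint)
      moreover have "R \<subseteq> {1..n}" using R(1) by fastforce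
      ultimately show "R \<union> {1..l} \<in> {S \<in> ksubsets n k. {1..l} \<subseteq> S}"
        using assms by auto
    qed
    show "\<forall>R\<in>{R. R \<subseteq> {l<..n} \<and> card R = k - l}. R \<union> {1..l} - {1..l} = R" by fastforce
  qed auto
  then have "card {S \<in> ksubsets n k. {1..l} \<subseteq> S} = card {R. R \<subseteq> {l<..n} \<and> card R = k - l}"
    by (rule bij_betw_same_card)
  also have "\<dots> = (n - l) choose (k - l)" by (subst n_subsets) auto
  finally show ?thesis .
qed

section \<open>From random permutations to random subsets\<close>

lemma permutes_mapping_subset:
  assumes "finite A" "S \<subseteq> A" "S' \<subseteq> A" "card S = card S'"
  obtains p where "p permutes A" "p ` S = S'"
proof -
  have fin: "finite S" "finite S'" using assms finite_subset by auto
  obtain f where f: "bij_betw f S S'"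
    using finite_same_card_bij[OF fin assms(4)] by blast
  have "card (A - S) = card (A - S')" using assms fin by (simp add: card_Diff_subset)
  then obtain g where g: "bij_betw g (A - S) (A - S')"
    using finite_same_card_bij[of "A - S" "A - S'"] assms(1) by auto
  define p where "p x = (if x \<in> S then f x else if x \<in> A then g x else x)" for x
  have 1: "bij_betw p S S'" using f by (subst bij_betw_cong[of S p f]) (auto simp: p_def)
  have 2: "bij_betw p (A - S) (A - S')"
    using g by (subst bij_betw_cong[of "A - S" p g]) (auto simp: p_def)
  have "bij_betw p (S \<union> (A - S)) (S' \<union> (A - S'))" using 1 2 by (rule bij_betw_combine) auto
  moreover have "S \<union> (A - S) = A" "S' \<union> (A - S') = A" using assms by auto
  ultimately have "p permutes A" using assms(2)
    by (intro bij_imp_permutes) (auto simp: p_def)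
  then show ?thesis using that 1 by (auto simp: bij_betw_def)
qed

text \<open>Composition with a permutation that carries \<open>S\<close> to \<open>S'\<close> is a
  bijection between the two families.\<close>

lemma card_permutations_image_eq:
  assumes "finite A" "K \<subseteq> A" "S \<subseteq> A" "S' \<subseteq> A" "card S = card S'"
  shows "card {a. a permutes A \<and> a ` K = S} = card {a. a permutes A \<and> a ` K = S'}"
proof -
  obtain p where p: "p permutes A" "p ` S = S'"
    using permutes_mapping_subset[OF assms(1,3-5)] by blast
  have ip: "inv p ` S' = S" using p by (metis image_inv_f_f permutes_inj)
  have "bij_betw ((\<circ>) p) {a. a permutes A \<and> a ` K = S} {a. a permutes A \<and> a ` K = S'}"
  proof (rule bij_betw_byWitness[where f' = "(\<circ>) (inv p)"])
    show "\<forall>a\<in>{a. a permutes A \<and> a ` K = S}. inv p \<circ> (p \<circ> a) = a"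
      using p(1) by (auto simp: o_assoc permutes_inv_o)
    show "\<forall>a\<in>{a. a permutes A \<and> a ` K = S'}. p \<circ> (inv p \<circ> a) = a"
      using p(1) by (auto simp: o_assoc permutes_inv_o)
    show "(\<circ>) p ` {a. a permutes A \<and> a ` K = S} \<subseteq> {a. a permutes A \<and> a ` K = S'}"
      using p by (simp add: image_subset_iff permutes_compose image_comp[symmetric] del: o_apply)
    show "(\<circ>) (inv p) ` {a. a permutes A \<and> a ` K = S'} \<subseteq> {a. a permutes A \<and> a ` K = S}"
      using p(1) ip by (simp add: image_subset_iff permutes_compose permutes_inv image_comp[symmetric] del: o_apply)
  qed
  then show ?thesis by (rule bij_betw_same_card)
qed

lemma prefix_image:
  fixes a :: "nat \<Rightarrow> nat"
  assumes "a permutes {1..n}" "k \<le> n"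
  shows "a ` {1..k} \<subseteq> {1..n}" "card (a ` {1..k}) = k"
proof -
  have "inj_on a {1..k}" using assms(1) permutes_inj inj_on_subset by blast
  then show "card (a ` {1..k}) = k" by (simp add: card_image)
  show "a ` {1..k} \<subseteq> {1..n}" using permutes_in_image[OF assms(1)] assms(2) by fastforce
qed

text \<open>The set of the first \<open>k\<close> values is uniform on the k-subsets, because all
  fibres of the map from a permutation to its prefix set have the same size
  \<open>c\<close>.\<close>

lemma sum_permutations_prefix:
  fixes f :: "nat set \<Rightarrow> real"
  assumes "k \<le> n"
  shows "real (n choose k) * (\<Sum>a | a permutes {1..n}. f (a ` {1..k})) = fact n * sum f (ksubsets n k)"
proof -
  let ?P = "{a. a permutes {1..n}}"
  define c where "c = card {a. a permutes {1..n} \<and> a ` {1..k} = {1..k}}"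
  have c: "card {a. a permutes {1..n} \<and> a ` {1..k} = S} = c" if "S \<in> ksubsets n k" for S
    unfolding c_def using that assms by (intro card_permutations_image_eq) auto
  have finP: "finite ?P" by (rule finite_permutations) simp
  have img: "(\<lambda>a. a ` {1..k}) ` ?P \<subseteq> ksubsets n k"
    using prefix_image[OF _ assms] by auto
  have group: "(\<Sum>a\<in>?P. g (a ` {1..k})) = real c * sum g (ksubsets n k)" for g :: "nat set \<Rightarrow> real"
  proof -
    have "(\<Sum>a\<in>?P. g (a ` {1..k})) = (\<Sum>S\<in>ksubsets n k. \<Sum>a | a \<in> ?P \<and> a ` {1..k} = S. g (a ` {1..k}))"
      by (rule sum.group[symmetric]) (use finP img in auto)
    also have "\<dots> = (\<Sum>S\<in>ksubsets n k. real c * g S)"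
      using c by (intro sum.cong refl) simp
    finally show ?thesis by (simp add: sum_distrib_left)
  qed
  \<comment> \<open>The constant function 1 yields the total count, which fixes \<open>c\<close>
    without computing a fibre.\<close>
  have "fact n = real c * (n choose k)"
    using group[of "\<lambda>_. 1"] card_permutations[of "{1..n}" n] n_subsets[of "{1..n}" k] by simp
  then show ?thesis using group[of f] by simp
qed

section \<open>The expected value of the selected element\<close>

definition flip :: "nat \<Rightarrow> nat \<Rightarrow> nat \<Rightarrow> nat" where
  "flip lo hi x = (if lo \<le> x \<and> x \<le> hi then lo + hi - x else x)"

lemma flip_flip: "flip lo hi (flip lo hi x) = x"
  by (auto simp: flip_def)

lemma bij_flip: "bij (flip lo hi)"
  by (rule o_bij[where g = "flip lo hi"]) (auto simp: flip_flip)

lemma flip_permutes: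
  assumes "1 \<le> lo" "hi \<le> n"
  shows "flip lo hi permutes {1..n}"
  proof (rule bij_imp_permutes)
  show "bij_betw (flip lo hi) {1..n} {1..n}"
    using assms by (intro bij_betw_byWitness[where f' = "flip lo hi"]) (auto simp: flip_flip, auto simp: flip_def)
qed (use assms in \<open>auto simp: flip_def\<close>)

lemma threshold_props:
  assumes "a permutes {1..n}" "1 \<le> l" "l \<le> k" "k \<le> n"
  shows "threshold k l a \<in> a ` {1..k}" "card {x \<in> a ` {1..k}. x < threshold k l a} = l - 1"
    "l \<le> threshold k l a" "threshold k l a \<le> n"
proof -
  let ?t = "threshold k l a"
  have c: "l - 1 < card (a ` {1..k})" using prefix_image[OF assms(1,4)] assms by simp
  show t: "?t \<in> a ` {1..k}" "card {x \<in> a ` {1..k}. x < ?t} = l - 1"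
    unfolding threshold_def using sorted_list_of_set_nth_props[OF _ c] by auto
  show "?t \<le> n" using t(1) prefix_image[OF assms(1,4)] by fastforce
  have "{x \<in> a ` {1..k}. x < ?t} \<subseteq> {1..<?t}" using prefix_image(1)[OF assms(1,4)] by fastforce
  then have "card {x \<in> a ` {1..k}. x < ?t} \<le> card {1..<?t}" by (rule card_mono[rotated]) simp
  moreover have "1 \<le> ?t" using t(1) prefix_image(1)[OF assms(1,4)] by fastforce
  ultimately show "l \<le> ?t" using t(2) by simp
qed

text \<open>The threshold is characterized as the prefix value with exactly \<open>l - 1\<close>
  smaller prefix values. Since \<open>p\<close> is injective, fixes this value and respects being
  below it, the characterization carries over to \<open>p \<circ> a\<close>.\<close>

lemma threshold_comp:
  assumes "a permutes {1..n}" "1 \<le> l" "l \<le> k" "k \<le> n"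
    and "inj p" "p (threshold k l a) = threshold k l a"
    and "\<And>x. p x < threshold k l a \<longleftrightarrow> x < threshold k l a"
  shows "threshold k l (p \<circ> a) = threshold k l a"
proof -
  let ?t = "threshold k l a"
  note t = threshold_props[OF assms(1-4)]
  have im: "(p \<circ> a) ` {1..k} = p ` (a ` {1..k})" by (simp only: image_comp)
  have "{x \<in> p ` (a ` {1..k}). x < ?t} = p ` {x \<in> a ` {1..k}. x < ?t}"
    using assms(7) by auto
  then have "card {x \<in> p ` (a ` {1..k}). x < ?t} = l - 1"
    using t(2) assms(5) by (simp add: card_image inj_on_subset)
  moreover have "?t \<in> p ` (a ` {1..k})" using t(1) assms(6) by (metis image_eqI)
  ultimately show ?thesis
    unfolding threshold_def[of k l "p \<circ> a"] im by (intro sorted_list_of_set_nth_eqI) auto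
qed

text \<open>The rule only compares values with the threshold. These comparisons do not change under
  \<open>p\<close>, so the same position is selected.\<close>

lemma rule_select_comp:
  assumes "\<And>x. p x < threshold k l a \<longleftrightarrow> x < threshold k l a"
    and "threshold k l (p \<circ> a) = threshold k l a"
  shows "rule_select n k l (p \<circ> a) = p (rule_select n k l a)"
  using assms unfolding rule_select_def Let_def by auto

lemma rule_select_pos:
  assumes "k < n"
  obtains i where "i \<in> {1..n - k}" "rule_select n k l a = a (k + i)"
proof -
  let ?I = "{i \<in> {1..n - k}. a (k + i) < threshold k l a}"
  have "Min ?I \<in> ?I" if "?I \<noteq> {}" by (rule Min_in) (use that in auto)
  then have "(if ?I \<noteq> {} then Min ?I else n - k) \<in> {1..n - k}" using assms by auto
  then show ?thesis using that unfolding rule_select_def Let_def by blast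
qed

lemma rule_select_not_prefix:
  assumes "a permutes {1..n}" "k < n"
  shows "rule_select n k l a \<in> {1..n} - a ` {1..k}"
proof -
  obtain i where i: "i \<in> {1..n - k}" "rule_select n k l a = a (k + i)"
    using rule_select_pos[OF assms(2)] .
  have "k + i \<in> {1..n}" using i(1) assms(2) by auto
  then have "a (k + i) \<in> {1..n}" using permutes_in_image[OF assms(1)] by blast
  moreover have "a (k + i) \<notin> a ` {1..k}"
    using permutes_inj[OF assms(1)] i(1) by (auto simp: inj_eq)
  ultimately show ?thesis using i(2) by simp
qed

text \<open>Of the \<open>t - 1\<close> values below the threshold \<open>t\<close> only
  \<open>l - 1\<close> occur in the prefix. If \<open>t > l\<close>, one of them is still to come,
  and the rule stops at a value below \<open>t\<close>.\<close>

lemma rule_select_less_threshold: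
  assumes "a permutes {1..n}" "1 \<le> l" "l \<le> k" "k < n" "l < threshold k l a"
  shows "rule_select n k l a < threshold k l a"
proof -
  let ?t = "threshold k l a"
  let ?I = "{i \<in> {1..n - k}. a (k + i) < ?t}"
  have kn: "k \<le> n" using assms by simp
  note t = threshold_props[OF assms(1-3) kn]
  have "\<not> {1..<?t} \<subseteq> {x \<in> a ` {1..k}. x < ?t}"
  proof
    assume "{1..<?t} \<subseteq> {x \<in> a ` {1..k}. x < ?t}"
    from card_mono[OF _ this] have "card {1..<?t} \<le> l - 1" using t(2) by simp
    then show False using assms by simp
  qed
  then obtain v where v: "v \<in> {1..<?t}" "v \<notin> a ` {1..k}" by fastforce
  have "v \<in> a ` {1..n}" using v(1) t(4) permutes_image[OF assms(1)] by auto
  then obtain m where m: "m \<in> {1..n}" "v = a m" by blast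
  then have "m \<notin> {1..k}" using v(2) by blast
  then have "m - k \<in> ?I" using m v(1) by auto
  then have "?I \<noteq> {}" by blast
  then have "Min ?I \<in> ?I" by (intro Min_in) auto
  then show ?thesis using \<open>?I \<noteq> {}\<close> unfolding rule_select_def Let_def by auto
qed

text \<open>The reflected interval is the one that holds the selected value: \<open>{l+1..n}\<close>
  if the prefix has used up \<open>{1..l}\<close>, and \<open>{1..t-1}\<close> otherwise. It lies
  entirely on one side of \<open>t\<close>, so comparisons with \<open>t\<close> survive.\<close>

definition reflect :: "nat \<Rightarrow> nat \<Rightarrow> nat \<Rightarrow> nat \<Rightarrow> nat" where
  "reflect n l t = (if t = l then flip (l + 1) n else flip 1 (t - 1))"

lemma reflect_less_iff:
  assumes "1 \<le> t"
  shows "reflect n l t x < t \<longleftrightarrow> x < t"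
  using assms by (auto simp: reflect_def flip_def)

lemma reflect_fix:
  assumes "1 \<le> t"
  shows "reflect n l t t = t"
  using assms by (auto simp: reflect_def flip_def)

text \<open>The reflection depends on the permutation only through its threshold; as that is
  preserved, reflecting twice uses the same map and gives an involution.\<close>

lemma threshold_reflect:
  assumes "a permutes {1..n}" "1 \<le> l" "l \<le> k" "k \<le> n"
  shows "threshold k l (reflect n l (threshold k l a) \<circ> a) = threshold k l a"
proof (rule threshold_comp[OF assms])
  have "1 \<le> threshold k l a" using threshold_props(3)[OF assms] assms by simp
  then show "reflect n l (threshold k l a) (threshold k l a) = threshold k l a"
    "\<And>x. reflect n l (threshold k l a) x < threshold k l a \<longleftrightarrow> x < threshold k l a"
    by (simp_all add: reflect_less_iff reflect_fix)
  show "inj (reflect n l (threshold k l a))"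
    using bij_flip by (auto simp: reflect_def bij_is_inj)
qed

text \<open>A value and its mirror image add up to the sum of the interval's endpoints:
  \<open>1 + (t - 1) = t\<close> in general, and \<open>(l + 1) + n\<close> if
  \<open>t = l\<close>.\<close>

lemma rule_select_reflect:
  assumes "a permutes {1..n}" "1 \<le> l" "l \<le> k" "k < n"
  shows "rule_select n k l a + rule_select n k l (reflect n l (threshold k l a) \<circ> a) =
    threshold k l a + (if threshold k l a = l then n + 1 else 0)"
proof -
  have kn: "k \<le> n" using assms by simp
  let ?t = "threshold k l a" and ?s = "rule_select n k l a"
  have t: "1 \<le> ?t" "l \<le> ?t" "?t \<le> n" using threshold_props(3,4)[OF assms(1-3) kn] assms by simp_all
  have s: "?s \<in> {1..n}" "?s \<notin> a ` {1..k}" using rule_select_not_prefix[OF assms(1,4)] by auto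
  have comp: "rule_select n k l (reflect n l ?t \<circ> a) = reflect n l ?t ?s"
    by (rule rule_select_comp[OF reflect_less_iff[OF t(1)] threshold_reflect[OF assms(1-3) kn]])
  show ?thesis
  proof (cases "?t = l")
    case True
    \<comment> \<open>The selected value lies outside the prefix, hence it exceeds
      \<open>l\<close>.\<close>
    then have "{1..l} \<subseteq> a ` {1..k}"
      using order_stat_eq_rank_iff[OF prefix_image(1)[OF assms(1) kn] assms(2)] assms prefix_image(2)[OF assms(1) kn]
      by (simp add: threshold_def)
    then have "l < ?s" using s by (meson atLeastAtMost_iff linorder_not_le subsetD)
    then show ?thesis using True s comp by (simp add: reflect_def flip_def)
  next
    case False
    then have "?s < ?t" using rule_select_less_threshold[OF assms] t by simp
    then have "?s \<le> ?t - 1" by simp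
    then show ?thesis using False s comp t(1) by (simp add: reflect_def flip_def)
  qed
qed

text \<open>Each permutation is averaged with its reflection; the factor 2 keeps the identity in the
  natural numbers.\<close>

lemma sum_rule_select:
  assumes "1 \<le> l" "l \<le> k" "k < n"
  shows "2 * (\<Sum>a | a permutes {1..n}. rule_select n k l a) =
    (\<Sum>a | a permutes {1..n}. threshold k l a + (if threshold k l a = l then n + 1 else 0))"
proof -
  let ?P = "{a. a permutes {1..n}}"
  let ?\<phi> = "\<lambda>a. reflect n l (threshold k l a) \<circ> a"
  have kn: "k \<le> n" using assms by simp
  have inv: "?\<phi> (?\<phi> a) = a" if "a permutes {1..n}" for a
    unfolding threshold_reflect[OF that assms(1,2) kn]
    by (auto simp: fun_eq_iff reflect_def flip_flip)
  have perm: "?\<phi> a permutes {1..n}" if "a permutes {1..n}" for a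
  proof -
    have "reflect n l (threshold k l a) permutes {1..n}"
      using threshold_props(4)[OF that assms(1,2) kn] unfolding reflect_def
      by (simp add: flip_permutes del: One_nat_def)
    then show ?thesis by (rule permutes_compose[OF that])
  qed
  have "(\<Sum>a\<in>?P. rule_select n k l (?\<phi> a)) = (\<Sum>a\<in>?P. rule_select n k l a)"
    by (rule sum.reindex_bij_witness[where i = ?\<phi> and j = ?\<phi>]) (use inv perm in auto)
  then have "2 * (\<Sum>a\<in>?P. rule_select n k l a) =
      (\<Sum>a\<in>?P. rule_select n k l a + rule_select n k l (?\<phi> a))"
    by (simp add: sum.distrib)
  also have "\<dots> = (\<Sum>a\<in>?P. threshold k l a + (if threshold k l a = l then n + 1 else 0))"
    using rule_select_reflect assms by (intro sum.cong refl) auto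
  finally show ?thesis .
qed

section \<open>Closed form of the expectation\<close>

lemma sum_ksubsets_threshold:
  assumes "1 \<le> l" "l \<le> k" "k < n"
  shows "(\<Sum>S\<in>ksubsets n k. real (order_stat l S + (if order_stat l S = l then n + 1 else 0))) =
    l * (Suc n choose Suc k) + (n + 1) * ((n - l) choose (k - l))"
proof -
  have "(\<Sum>S\<in>ksubsets n k. (if order_stat l S = l then n + 1 else 0)) =
      (\<Sum>S\<in>ksubsets n k. (if {1..l} \<subseteq> S then n + 1 else 0))"
    using order_stat_eq_rank_iff[OF _ assms(1)] assms(2) by (intro sum.cong refl if_cong) auto
  also have "\<dots> = (\<Sum>S\<in>{S \<in> ksubsets n k. {1..l} \<subseteq> S}. n + 1)"
    by (rule sum.inter_filter[symmetric]) simp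
  also have "\<dots> = (n + 1) * ((n - l) choose (k - l))"
    using card_ksubsets_containing[of l k n] assms by (simp only: sum_constant) simp
  finally have "(\<Sum>S\<in>ksubsets n k. order_stat l S + (if order_stat l S = l then n + 1 else 0)) =
      l * (Suc n choose Suc k) + (n + 1) * ((n - l) choose (k - l))"
    using sum_order_stat[OF assms(1,2), of n] by (simp only: sum.distrib)
  then show ?thesis by (simp only: of_nat_sum[symmetric])
qed

lemma expected_select_eq:
  assumes "1 \<le> l" "l \<le> k" "k < n"
  shows "expected_select n k l =
    (real n + 1) / 2 * (real l / (real k + 1) + real (k choose l) / real (n choose l))"
proof -
  let ?P = "{a. a permutes {1..n}}"
  define g where "g S = real (order_stat l S + (if order_stat l S = l then n + 1 else 0))" for S
  have fin: "finite ?P" by (rule finite_permutations) simp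
  have ne: "?P \<noteq> {}" using permutes_id by blast
  have card: "card ?P = fact n" by (rule card_permutations) simp_all
  have kn: "k \<le> n" using assms by simp
  have "expected_select n k l = (\<Sum>a\<in>?P. real (rule_select n k l a)) / fact n"
    unfolding expected_select_def using integral_pmf_of_set[OF ne fin] card by simp
  also have "(\<Sum>a\<in>?P. real (rule_select n k l a)) = (\<Sum>a\<in>?P. g (a ` {1..k})) / 2"
    using arg_cong[OF sum_rule_select[OF assms], of real] unfolding g_def threshold_def[symmetric] by simp
  also have "(\<Sum>a\<in>?P. g (a ` {1..k})) / 2 / fact n = (\<Sum>a\<in>?P. g (a ` {1..k})) / fact n / 2"
    by simp
  also have "(\<Sum>a\<in>?P. g (a ` {1..k})) / fact n = fact n * sum g (ksubsets n k) / (n choose k) / fact n"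
    using sum_permutations_prefix[OF kn, of g] kn by (simp add: field_simps)
  also have "\<dots> = sum g (ksubsets n k) / (n choose k)" by simp
  also have "sum g (ksubsets n k) = l * (Suc n choose Suc k) + (n + 1) * ((n - l) choose (k - l))"
    unfolding g_def by (rule sum_ksubsets_threshold[OF assms])
  finally have E: "expected_select n k l =
    (real l * (Suc n choose Suc k) + (real n + 1) * ((n - l) choose (k - l))) / (2 * (n choose k))"
    by (simp add: algebra_simps)
  have pos: "real (n choose k) > 0" "real (n choose l) > 0" using assms by simp_all
  have 1: "real (Suc n choose Suc k) = (real n + 1) / (real k + 1) * (n choose k)"
    using arg_cong[OF Suc_times_binomial[of k n], of real]
    by (simp add: field_simps del: binomial_Suc_Suc)
  \<comment> \<open>The probability that a random k-subset contains \<open>{1..l}\<close>, rewritten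
    by \<open>(n choose k) * (k choose l) = (n choose l) * ((n - l) choose (k - l))\<close>.\<close>
  have 2: "real ((n - l) choose (k - l)) = real (k choose l) / (n choose l) * (n choose k)"
    using arg_cong[OF choose_mult[OF assms(2) kn], of real] pos by (simp add: field_simps)
  have alg: "(x * (N / K * C) + N * (q * C)) / (2 * C) = N / 2 * (x / K + q)"
    if "C \<noteq> 0" for x N K C q :: real
  proof -
    have "x * (N / K * C) + N * (q * C) = N * (x / K + q) * C" by (simp add: algebra_simps)
    then show ?thesis using that by simp
  qed
  show ?thesis unfolding E 1 2 of_nat_mult of_nat_numeral by (rule alg) (use pos in simp)
qed

section \<open>Asymptotics of the minimizer\<close>

lemma binomial_ratio_eq_prod:
  assumes "l \<le> k" "k \<le> n"
  shows "real (k choose l) / real (n choose l) = (\<Prod>i<l. real (k - i) / real (n - i))"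
proof -
  have "real (k choose l) / real (n choose l) =
      (\<Prod>i<l. (real (k - i) / real (l - i)) / (real (n - i) / real (l - i)))"
    using assms by (simp only: binomial_altdef_of_nat[of l] order_trans[OF assms] atLeast0LessThan prod_dividef)
  also have "\<dots> = (\<Prod>i<l. real (k - i) / real (n - i))"
    by (intro prod.cong) auto
  finally show ?thesis .
qed

lemma binomial_ratio_le:
  assumes "l \<le> k" "k \<le> n"
  shows "real (k choose l) / real (n choose l) \<le> (real k / real n) ^ l"
proof -
  have "(\<Prod>i<l. real (k - i) / real (n - i)) \<le> (\<Prod>i<l. real k / real n)"
  proof (rule prod_mono, intro conjI)
    fix i assume "i \<in> {..<l}"
    then have i: "i < k" "i < n" using assms by auto
    then have "real i * real k \<le> real i * real n" using assms by (intro mult_left_mono) auto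
    then have "(real k - real i) * real n \<le> real k * (real n - real i)" by (simp add: algebra_simps)
    then show "real (k - i) / real (n - i) \<le> real k / real n"
      using i by (simp add: divide_simps of_nat_diff)
  qed simp
  then show ?thesis using binomial_ratio_eq_prod[OF assms] by simp
qed

text \<open>Every factor of the product is at least \<open>(k + 1 - l) / n\<close>, and Bernoulli's
  inequality controls the loss against \<open>(k + 1) / n\<close>. The base has \<open>k + 1\<close>
  in order to match the denominator of the first summand of \<open>cost\<close>.\<close>

lemma binomial_ratio_ge:
  assumes "l \<le> k" "k \<le> n" "0 < n"
  shows "((real k + 1) / n) ^ l * (1 - (real l)\<^sup>2 / (real k + 1)) \<le> real (k choose l) / real (n choose l)"
proof -
  have "1 + real l * (- (real l / (real k + 1))) \<le> (1 + (- (real l / (real k + 1)))) ^ l"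
    using assms by (intro Bernoulli_inequality) (simp add: divide_simps)
  then have "((real k + 1) / n) ^ l * (1 - (real l)\<^sup>2 / (real k + 1))
      \<le> ((real k + 1) / n) ^ l * (1 - real l / (real k + 1)) ^ l"
    by (intro mult_left_mono) (auto simp: power2_eq_square)
  also have "\<dots> = ((real k + 1 - real l) / n) ^ l"
  proof -
    have "(real k + 1) * (1 - real l / (real k + 1)) = real k + 1 - real l"
      by (simp add: right_diff_distrib)
    then have "(real k + 1) / n * (1 - real l / (real k + 1)) = (real k + 1 - real l) / n"
      by (metis times_divide_eq_left)
    then show ?thesis by (simp only: power_mult_distrib[symmetric])
  qed
  also have "\<dots> = (\<Prod>i<l. (real k + 1 - real l) / real n)" by simp
  also have "\<dots> \<le> (\<Prod>i<l. real (k - i) / real (n - i))"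
  proof (rule prod_mono, intro conjI)
    fix i assume "i \<in> {..<l}"
    then show "(real k + 1 - real l) / real n \<le> real (k - i) / real (n - i)"
      using assms by (intro frac_le) (auto simp: of_nat_diff)
  qed (use assms in auto)
  finally show ?thesis using binomial_ratio_eq_prod[OF assms(1,2)] by simp
qed

section \<open>The normalized expectation near its minimum\<close>

definition cost :: "nat \<Rightarrow> nat \<Rightarrow> nat \<Rightarrow> real" where
  "cost n k l = real l / (real k + 1) + real (k choose l) / real (n choose l)"

lemma cost_upper_bound:
  "\<forall>\<^sub>F n in at_top. \<exists>k l. 1 \<le> l \<and> l \<le> k \<and> k \<le> n - 1 \<and>
     cost n k l \<le> (exp 1 * ln (real n) + exp 1 + 1) / real n"
proof -
  have "\<forall>\<^sub>F n::nat in at_top. ln (real n) + 1 \<le> real n / exp 1 - 1" by real_asymp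
  \<comment> \<open>This makes the rounded pair below admissible:
    \<open>l < ln n + 1 <= n / e - 1 < k\<close>.\<close>
  moreover have "\<forall>\<^sub>F n::nat in at_top. n \<ge> 3" by (rule eventually_ge_at_top)
  ultimately show ?thesis
  proof eventually_elim
    case (elim n)
    define k where "k = nat \<lfloor>real n / exp 1\<rfloor>"
    define l where "l = nat \<lceil>ln (real n)\<rceil>"
    have k: "real k \<le> real n / exp 1" "real n / exp 1 < real k + 1"
      unfolding k_def by (simp_all add: of_nat_nat)
    have lnpos: "ln (real n) > 0" using elim by simp
    have l: "ln (real n) \<le> real l" "real l < ln (real n) + 1"
      unfolding l_def using lnpos by linarith+
    have "real n / exp 1 < real n" using elim by (simp add: divide_simps)
    then have kn: "k < n" using k by linarith
    have lk: "l \<le> k" using k l elim(1) by linarith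
    have l1: "1 \<le> l" using l lnpos by linarith
    have "real l / (real k + 1) \<le> (ln (real n) + 1) / (real n / exp 1)"
      using k l lnpos elim by (intro frac_le) auto
    moreover have "real (k choose l) / real (n choose l) \<le> 1 / real n"
    proof -
      have "real (k choose l) / real (n choose l) \<le> (real k / real n) ^ l"
        using lk kn by (intro binomial_ratio_le) auto
      also have "real k / real n \<le> exp (- 1)"
        using k(1) elim by (simp add: field_simps exp_minus)
      then have "(real k / real n) ^ l \<le> exp (- 1) ^ l" by (intro power_mono) auto
      also have "\<dots> = exp (- real l)" by (simp add: exp_of_nat_mult[symmetric])
      also have "\<dots> \<le> exp (- ln (real n))" using l by simp
      also have "\<dots> = 1 / real n" using elim by (simp add: exp_minus field_simps)
      finally show ?thesis .
    qed
    ultimately have "cost n k l \<le> (exp 1 * ln (real n) + exp 1 + 1) / real n"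
      unfolding cost_def by (simp add: add_divide_distrib algebra_simps)
    then show ?case using l1 lk kn by (intro exI[of _ k] exI[of _ l]) auto
  qed
qed

text \<open>Both summands of \<open>cost\<close> are nonnegative, so each is at most
  \<open>M / n\<close>. The first equals \<open>l * exp w / n\<close>, which bounds
  \<open>l * exp w\<close> and, as \<open>w >= 0\<close>, also \<open>l\<close> by \<open>M\<close>.
  The second is at least \<open>exp (- l * w) / 2\<close>, and taking logarithms gives the lower
  bound on \<open>l * w\<close>.\<close>

lemma near_optimal_bounds:
  fixes M :: real
  assumes "1 \<le> l" "l \<le> k" "k < n" "cost n k l \<le> M / n" "2 * M\<^sup>2 \<le> n"
  defines "w \<equiv> ln (real n / (real k + 1))"
  shows "0 \<le> w" "real l * exp w \<le> M" "ln (real n) - ln (2 * M) \<le> real l * w"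
    "real l * exp w / n \<le> cost n k l"
proof -
  have n: "real n > 0" using assms by simp
  have ew: "exp w = real n / (real k + 1)" unfolding w_def using n by simp
  have ratio: "1 \<le> real n / (real k + 1)" using assms by simp
  then show w: "0 \<le> w" unfolding w_def by (rule ln_ge_zero)
  have "0 \<le> real (k choose l) / real (n choose l)" by simp
  then have c: "real l / (real k + 1) \<le> cost n k l" unfolding cost_def by simp
  then show "real l * exp w / n \<le> cost n k l" unfolding ew using n by simp
  have "real l / (real k + 1) \<le> M / n" using c assms(4) by simp
  then show lM: "real l * exp w \<le> M" unfolding ew using n by (simp add: field_simps)
  have "real l * 1 \<le> real l * exp w" using w by (intro mult_left_mono) auto
  then have lM': "real l \<le> M" using lM by simp
  have M: "0 < M" using lM' assms(1) by linarith
  have "(real l)\<^sup>2 / (real k + 1) = real l * (real l / (real k + 1))" by (simp add: power2_eq_square)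
  also have "\<dots> \<le> M * (M / n)"
    using lM' \<open>real l / (real k + 1) \<le> M / n\<close> M by (intro mult_mono) auto
  also have "\<dots> \<le> 1 / 2" using assms(5) n by (simp add: field_simps power2_eq_square)
  \<comment> \<open>The Bernoulli factor costs at most a factor 2, which ends up inside
    \<open>ln (2 * M)\<close>.\<close>
  finally have half: "1 / 2 \<le> 1 - (real l)\<^sup>2 / (real k + 1)" by simp
  have inv: "(real k + 1) / n = exp (- w)" using ew by (simp add: exp_minus)
  have "exp (- w) ^ l * (1 / 2) \<le> ((real k + 1) / n) ^ l * (1 - (real l)\<^sup>2 / (real k + 1))"
    unfolding inv using half by (intro mult_left_mono) auto
  also have "\<dots> \<le> real (k choose l) / real (n choose l)"
    using assms by (intro binomial_ratio_ge) auto
  also have "\<dots> \<le> cost n k l" unfolding cost_def by simp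
  also have "\<dots> \<le> M / n" by (rule assms(4))
  finally have "exp (- (real l * w)) \<le> 2 * M / n" by (simp add: exp_of_nat_mult[symmetric] mult.commute)
  then have "ln (exp (- (real l * w))) \<le> ln (2 * M / n)" using M n by (subst ln_le_cancel_iff) auto
  then show "ln (real n) - ln (2 * M) \<le> real l * w" using M n by (simp add: ln_div)
qed

text \<open>Eliminating \<open>r\<close> gives \<open>exp (w - 1) <= w * d\<close> with
  \<open>d = A / (e * B)\<close> tending to 1. Since \<open>exp (w - 1)\<close> exceeds
  \<open>w\<close> by at least \<open>(w - 1)^2 / 4\<close>, this forces \<open>w\<close> to 1; then
  \<open>r\<close> is squeezed between \<open>B / w\<close> and \<open>A / exp w\<close>.\<close>

lemma tendsto_one_of_exp_bounds:
  fixes r w A B :: "nat \<Rightarrow> real"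
  assumes w: "\<forall>\<^sub>F n in at_top. 0 \<le> w n" and r: "\<forall>\<^sub>F n in at_top. 0 \<le> r n"
    and upper: "\<forall>\<^sub>F n in at_top. r n * exp (w n) \<le> A n"
    and lower: "\<forall>\<^sub>F n in at_top. B n \<le> r n * w n"
    and A: "A \<longlonglongrightarrow> exp 1" and B: "B \<longlonglongrightarrow> 1"
  shows "w \<longlonglongrightarrow> 1" "r \<longlonglongrightarrow> 1"
proof -
  define d where "d n = A n / (exp 1 * B n)" for n
  have d: "d \<longlonglongrightarrow> 1" unfolding d_def using tendsto_divide[OF A tendsto_mult[OF tendsto_const[of "exp 1"] B]] by simp
  have Bpos: "\<forall>\<^sub>F n in at_top. 0 < B n" using B by (rule order_tendstoD) simp
  \<comment> \<open>With \<open>d < 5/4\<close> the estimate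
    \<open>(w - 1)^2 <= 4 * w * (d - 1)\<close> implies \<open>(w - 1)^2 <= w\<close>, hence
    \<open>w <= 3\<close>. This is the source of the constant \<open>12 = 4 * 3\<close>.\<close>
  have dle: "\<forall>\<^sub>F n in at_top. d n < 5 / 4" using d by (rule order_tendstoD) simp
  have pos: "\<forall>\<^sub>F n in at_top. 0 < w n"
    using w r lower Bpos
  proof eventually_elim
    case (elim n)
    then have "0 < r n * w n" by linarith
    then show ?case using elim by (auto simp: zero_less_mult_iff)
  qed
  have bound: "\<forall>\<^sub>F n in at_top. norm ((w n - 1)\<^sup>2) \<le> 12 * (d n - 1)"
    using pos r lower upper Bpos dle
  proof eventually_elim
    case (elim n)
    have "exp (w n) * B n \<le> exp (w n) * (r n * w n)" using elim by simp
    also have "\<dots> = (r n * exp (w n)) * w n" by (simp add: mult_ac)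
    also have "\<dots> \<le> A n * w n" using elim by (intro mult_right_mono) auto
    finally have "exp (w n) / exp 1 \<le> w n * d n"
      using elim by (simp add: d_def field_simps)
    then have *: "exp (w n - 1) \<le> w n * d n" by (simp add: exp_diff)
    \<comment> \<open>Squaring \<open>1 + y <= exp y\<close> at \<open>y = (w - 1) / 2\<close> keeps
      a quadratic term; the tangent bound at \<open>w - 1\<close> itself would only give
      \<open>w <= w * d\<close>. Positivity of \<open>w\<close> makes the squared base
      nonnegative.\<close>
    have "(1 + (w n - 1) / 2)\<^sup>2 \<le> (exp ((w n - 1) / 2))\<^sup>2"
      using exp_ge_add_one_self[of "(w n - 1) / 2"] elim by (intro power_mono) (auto simp: field_simps)
    also have "\<dots> = exp (w n - 1)" by (simp add: exp_double[symmetric])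
    finally have q: "(w n - 1)\<^sup>2 \<le> 4 * w n * (d n - 1)" using *
      by (simp add: power2_eq_square field_simps)
    have "4 * w n * (d n - 1) \<le> 4 * w n * (1 / 4)" using elim by (intro mult_left_mono) auto
    then have "(w n - 1)\<^sup>2 \<le> w n" using q by simp
    then have "w n * (w n - 3) \<le> - 1" by (simp add: power2_eq_square algebra_simps)
    then have w3: "w n \<le> 3" using elim(1) by (smt (verit) mult_nonneg_nonneg)
    have "0 \<le> 4 * w n * (d n - 1)" using q by (smt (verit) zero_le_power2)
    then have "0 \<le> d n - 1" using elim(1) by (simp add: zero_le_mult_iff)
    then have "4 * w n * (d n - 1) \<le> 12 * (d n - 1)" using w3 by (intro mult_right_mono) auto
    then show ?case using q by simp
  qed
  have "(\<lambda>n. 12 * (d n - 1)) \<longlonglongrightarrow> 0" using d by (auto intro!: tendsto_eq_intros)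
  then have "(\<lambda>n. (w n - 1)\<^sup>2) \<longlonglongrightarrow> 0" by (rule Lim_null_comparison[OF bound])
  then have "(\<lambda>n. w n - 1) \<longlonglongrightarrow> 0" by simp
  then show w1: "w \<longlonglongrightarrow> 1" by (simp add: LIM_zero_iff)
  show "r \<longlonglongrightarrow> 1"
  proof (rule tendsto_sandwich)
    show "\<forall>\<^sub>F n in at_top. B n / w n \<le> r n"
      using pos lower by eventually_elim (simp add: field_simps)
    show "\<forall>\<^sub>F n in at_top. r n \<le> A n / exp (w n)"
      using upper by eventually_elim (simp add: field_simps)
    show "(\<lambda>n. B n / w n) \<longlonglongrightarrow> 1" using tendsto_divide[OF B w1] by simp
    show "(\<lambda>n. A n / exp (w n)) \<longlonglongrightarrow> 1" using tendsto_divide[OF A tendsto_exp[OF w1]] by simp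
  qed
qed

section \<open>The limits for the minimizing pair\<close>

theorem mainTheorem3:
  fixes k l :: "nat \<Rightarrow> nat"
  assumes "\<And>n. n \<ge> 2 \<Longrightarrow>
    is_arg_min (\<lambda>(k, l). expected_select n k l)
      (\<lambda>(k, l). 1 \<le> l \<and> l \<le> k \<and> k \<le> n - 1) (k n, l n)"
  shows "(\<lambda>n. real (k n)) \<sim>[at_top] (\<lambda>n. real n / exp 1) \<and>
    (\<lambda>n. real (l n)) \<sim>[at_top] (\<lambda>n. ln (real n) - 1) \<and>
    (\<lambda>n. expected_select n (k n) (l n)) \<sim>[at_top] (\<lambda>n. exp 1 / 2 * ln (real n))"
proof -
  \<comment> \<open>\<open>M n / n\<close> is the bound from \<open>cost_upper_bound\<close>. As
    \<open>M n\<close> grows like \<open>e * ln n\<close>, both \<open>(M n)^2 / n\<close> and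
    \<open>ln (2 * M n) / ln n\<close> vanish in the limit.\<close>
  define M where "M n = exp 1 * ln (real n) + exp 1 + 1" for n :: nat
  define w where "w n = ln (real n / (real (k n) + 1))" for n
  define r where "r n = real (l n) / ln (real n)" for n
  have large: "\<forall>\<^sub>F n::nat in at_top. n \<ge> 3" by (rule eventually_ge_at_top)
  have M_small: "\<forall>\<^sub>F n in at_top. 2 * (M n)\<^sup>2 \<le> real n" unfolding M_def by real_asymp
  have E: "expected_select n k' l' = (real n + 1) / 2 * cost n k' l'"
    if "1 \<le> l'" "l' \<le> k'" "k' \<le> n - 1" "n \<ge> 2" for n k' l'
    unfolding cost_def using that by (intro expected_select_eq) auto
  have range: "1 \<le> l n" "l n \<le> k n" "k n \<le> n - 1" if "n \<ge> 2" for n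
    using assms[OF that] by (auto simp: is_arg_min_def)
  \<comment> \<open>The factor \<open>(n + 1) / 2\<close> does not involve the pair, so a minimizer
    of the expectation minimizes \<open>cost\<close>.\<close>
  have opt: "cost n (k n) (l n) \<le> cost n k' l'"
    if "1 \<le> l'" "l' \<le> k'" "k' \<le> n - 1" "n \<ge> 2" for n k' l'
  proof -
    have "expected_select n (k n) (l n) \<le> expected_select n k' l'"
      using assms[OF that(4)] that by (auto simp: is_arg_min_def not_less)
    then show ?thesis using E[OF that] E[OF range[OF that(4)] that(4)] by simp
  qed
  have cost_le: "\<forall>\<^sub>F n in at_top. cost n (k n) (l n) \<le> M n / n"
    using cost_upper_bound large
  proof eventually_elim
    case (elim n)
    then obtain k' l' where "1 \<le> l'" "l' \<le> k'" "k' \<le> n - 1" "cost n k' l' \<le> M n / n"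
      unfolding M_def by auto
    then show ?case using opt[of l' k' n] elim(2) by linarith
  qed
  have bounds: "\<forall>\<^sub>F n in at_top. 0 \<le> w n \<and> real (l n) * exp (w n) \<le> M n \<and>
      ln (real n) - ln (2 * M n) \<le> real (l n) * w n \<and> real (l n) * exp (w n) / n \<le> cost n (k n) (l n)"
    using cost_le M_small large
  proof eventually_elim
    case (elim n)
    have "k n < n" using range[of n] elim by auto
    then show ?case unfolding w_def
      using near_optimal_bounds[of "l n" "k n" n "M n"] range[of n] elim by auto
  qed
  have Lpos: "\<forall>\<^sub>F n::nat in at_top. 0 < ln (real n)" by real_asymp
  have A: "(\<lambda>n. M n / ln (real n)) \<longlonglongrightarrow> exp 1" unfolding M_def by real_asymp
  have B: "(\<lambda>n. (ln (real n) - ln (2 * M n)) / ln (real n)) \<longlonglongrightarrow> 1" unfolding M_def by real_asymp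
  have upper: "\<forall>\<^sub>F n in at_top. r n * exp (w n) \<le> M n / ln (real n)"
    using bounds Lpos by eventually_elim (auto simp: r_def divide_right_mono)
  have lower: "\<forall>\<^sub>F n in at_top. (ln (real n) - ln (2 * M n)) / ln (real n) \<le> r n * w n"
    using bounds Lpos by eventually_elim (auto simp: r_def divide_right_mono)
  have w0: "\<forall>\<^sub>F n in at_top. 0 \<le> w n" using bounds by eventually_elim auto
  have r0: "\<forall>\<^sub>F n in at_top. 0 \<le> r n" using Lpos by eventually_elim (auto simp: r_def)
  note lims = tendsto_one_of_exp_bounds[OF w0 r0 upper lower A B]
  have "(\<lambda>n. real (k n)) \<sim>[at_top] (\<lambda>n. real n / exp 1)"
  proof (rule asymp_equivI', rule Lim_transform_eventually)
    \<comment> \<open>Since \<open>exp (- w n) = (k n + 1) / n\<close>, the term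
      \<open>e / n\<close> corrects for the \<open>+ 1\<close>.\<close>
    have "(\<lambda>n::nat. exp 1 / real n) \<longlonglongrightarrow> 0" by real_asymp
    from tendsto_diff[OF tendsto_mult[OF tendsto_const[of "exp 1"] tendsto_exp[OF tendsto_minus[OF lims(1)]]] this]
    show "(\<lambda>n. exp 1 * exp (- w n) - exp 1 / real n) \<longlonglongrightarrow> 1"
      by (simp add: exp_minus)
    show "\<forall>\<^sub>F n in at_top. exp 1 * exp (- w n) - exp 1 / real n = real (k n) / (real n / exp 1)"
      using large by eventually_elim (simp add: w_def exp_minus field_simps)
  qed
  moreover have "(\<lambda>n. real (l n)) \<sim>[at_top] (\<lambda>n. ln (real n) - 1)"
  proof (rule asymp_equivI', rule Lim_transform_eventually)
    \<comment> \<open>The shift by 1 is of lower order: \<open>l n\<close> is compared with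
      \<open>ln n\<close> and the quotient of the two scales tends to 1.\<close>
    have "(\<lambda>n::nat. ln (real n) / (ln (real n) - 1)) \<longlonglongrightarrow> 1" by real_asymp
    from tendsto_mult[OF lims(2) this]
    show "(\<lambda>n. r n * (ln (real n) / (ln (real n) - 1))) \<longlonglongrightarrow> 1" by simp
    show "\<forall>\<^sub>F n in at_top. r n * (ln (real n) / (ln (real n) - 1)) = real (l n) / (ln (real n) - 1)"
      using Lpos by eventually_elim (simp add: r_def)
  qed
  moreover have "(\<lambda>n. expected_select n (k n) (l n)) \<sim>[at_top] (\<lambda>n. exp 1 / 2 * ln (real n))"
  proof (rule asymp_equivI', rule tendsto_sandwich)
    \<comment> \<open>\<open>c\<close> collects \<open>(n + 1) / 2\<close> and the normalization
      \<open>e / 2 * n\<close>, so it tends to \<open>1 / e\<close>. The remaining factor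
      \<open>cost * n / ln n\<close> lies between \<open>r * exp w\<close> and
      \<open>M / ln n\<close>, both of which tend to \<open>e\<close>.\<close>
    define c where "c n = (real n + 1) / real n / exp 1" for n :: nat
    have c: "c \<longlonglongrightarrow> 1 / exp 1" unfolding c_def by (real_asymp simp: inverse_eq_divide)
    have eq: "\<forall>\<^sub>F n in at_top. expected_select n (k n) (l n) / (exp 1 / 2 * ln (real n)) =
        c n * (cost n (k n) (l n) * real n / ln (real n))"
      using large by eventually_elim (subst E, use range in \<open>auto simp: c_def\<close>)
    show "\<forall>\<^sub>F n in at_top. c n * (r n * exp (w n)) \<le>
        expected_select n (k n) (l n) / (exp 1 / 2 * ln (real n))"
      using eq bounds Lpos large
    proof eventually_elim
      case (elim n)
      have "r n * exp (w n) \<le> cost n (k n) (l n) * real n / ln (real n)"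
        using elim by (auto simp: r_def field_simps)
      then show ?case using elim by (simp add: c_def mult_left_mono del: times_divide_eq_left times_divide_eq_right)
    qed
    show "\<forall>\<^sub>F n in at_top. expected_select n (k n) (l n) / (exp 1 / 2 * ln (real n)) \<le>
        c n * (M n / ln (real n))"
      using eq cost_le Lpos large
    proof eventually_elim
      case (elim n)
      have "cost n (k n) (l n) * real n / ln (real n) \<le> M n / ln (real n)"
        using elim by (intro divide_right_mono) (auto simp: field_simps)
      then show ?case using elim by (simp add: c_def mult_left_mono del: times_divide_eq_left times_divide_eq_right)
    qed
    show "(\<lambda>n. c n * (r n * exp (w n))) \<longlonglongrightarrow> 1"
      using tendsto_mult[OF c tendsto_mult[OF lims(2) tendsto_exp[OF lims(1)]]] by simp
    show "(\<lambda>n. c n * (M n / ln (real n))) \<longlonglongrightarrow> 1"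
      using tendsto_mult[OF c A] by simp
  qed
  ultimately show ?thesis by blast
qed

end
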